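(* All the solutions $(n,m)$ of the diophantine equation $D_n^{(o)}=m!$ in positive integers $n,m$ are $(2,1)$ and $(4,3)$.
   Context: $D_n^{(e)}$ (respectively $D_n^{(o)}$) is the number of even (respectively odd) permutations of an $n$-element set without fixed points. They satisfy $D_0^{(e)}=1$, $D_1^{(e)}=0$, $D_0^{(o)}=0$, $D_1^{(o)}=0$, and $D_n^{(e)}=(n-1)(D_{n-2}^{(o)}+D_{n-1}^{(o)})$, $D_n^{(o)}=(n-1)(D_{n-2}^{(e)}+D_{n-1}^{(e)})$ for $n\ge2$. *)

theory Defs
  imports "HOL-Combinatorics.Permutations"
begin

definition derangements :: "'a set \<Rightarrow> ('a \<Rightarrow> 'a) set" where
  "derangements A = {p. p permutes A \<and> (\<forall>x\<in>A. p x \<noteq> x)}"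

definition even_derangement_number :: "nat \<Rightarrow> nat" where
  "even_derangement_number n = card {p \<in> derangements {1..n}. evenperm p}"

definition odd_derangement_number :: "nat \<Rightarrow> nat" where
  "odd_derangement_number n = card {p \<in> derangements {1..n}. \<not> evenperm p}"

end

theory Submission
  imports Defs
begin

text \<open>Size alone decides the equation: writing \<open>O(n)\<close> for the number of odd derangements, the
  recurrence gives \<open>(n - 1)! < O(n) < n!\<close> for \<open>n \<ge> 6\<close> (asymptotically \<open>O(n)\<close> is \<open>n! / (2e)\<close>),
  so only \<open>n \<le> 5\<close> remains.

  The recurrence comes from writing a permutation of \<open>insert a S\<close> uniquely as
  \<open>transpose a b \<circ> p\<close> with \<open>p\<close> a permutation of \<open>S\<close>. It is a derangement iff \<open>b \<in> S\<close> and \<open>p\<close> has no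
  fixed point except possibly \<open>b\<close>, and the transposition flips the parity.\<close>

definition parity_derangements :: "bool \<Rightarrow> 'a set \<Rightarrow> ('a \<Rightarrow> 'a) set" where
  "parity_derangements c A = {p \<in> derangements A. evenperm p = c}"

text \<open>The flag \<open>c\<close> is \<open>True\<close> for even and \<open>False\<close> for
  odd. Each recurrence refers only to the other parity, so one function carries both.\<close>

fun parity_derangement_number :: "bool \<Rightarrow> nat \<Rightarrow> nat" where
  "parity_derangement_number c 0 = (if c then 1 else 0)"
| "parity_derangement_number c (Suc 0) = 0"
| "parity_derangement_number c (Suc (Suc n)) =
     Suc n * (parity_derangement_number (\<not> c) n + parity_derangement_number (\<not> c) (Suc n))"

lemma finite_parity_derangements: "finite A \<Longrightarrow> finite (parity_derangements c A)"
  by (rule finite_subset[OF _ finite_permutations[of A]])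
    (auto simp: parity_derangements_def derangements_def)

text \<open>As \<open>p\<close> fixes \<open>a\<close>, the composite sends \<open>a\<close> to
  \<open>b\<close>. On \<open>S\<close> it agrees with \<open>p\<close>, except that the preimage of
  \<open>b\<close> goes to \<open>a\<close>, outside \<open>S\<close>; so its fixed points in
  \<open>S\<close> are those of \<open>p\<close> other than \<open>b\<close>. The two alternatives
  are \<open>p b \<noteq> b\<close> and \<open>p b = b\<close>.\<close>

lemma transpose_comp_in_derangements_iff:
  assumes "p permutes S" "a \<notin> S" "b \<in> insert a S"
  shows "transpose a b \<circ> p \<in> derangements (insert a S) \<longleftrightarrow>
    b \<in> S \<and> (p \<in> derangements S \<or> p \<in> derangements (S - {b}))"
proof -
  have pa: "p a = a" using assms by (simp add: permutes_not_in)
  have perm: "transpose a b \<circ> p permutes insert a S"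
    using assms by (intro permutes_compose permutes_swap_id permutes_subset[OF assms(1)]) auto
  have pS: "p x \<in> S" if "x \<in> S" for x using that assms(1) by (simp add: permutes_in_image)
  have fix_iff: "transpose a b (p x) = x \<longleftrightarrow> p x = x \<and> x \<noteq> b" if "x \<in> S" for x
    using pS[OF that] that assms(2) by (auto simp: transpose_def)
  have minus: "p permutes S - {b} \<longleftrightarrow> p b = b"
  proof
    assume "p permutes S - {b}"
    then show "p b = b" by (rule permutes_not_in) simp
  next
    assume "p b = b"
    then show "p permutes S - {b}" by (intro permutes_superset[OF assms(1)]) auto
  qed
  have "transpose a b \<circ> p \<in> derangements (insert a S) \<longleftrightarrow>
      b \<noteq> a \<and> (\<forall>x\<in>S. \<not> (p x = x \<and> x \<noteq> b))"
    using perm pa fix_iff by (auto simp: derangements_def)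
  also have "\<dots> \<longleftrightarrow> b \<in> S \<and> (p \<in> derangements S \<or> p \<in> derangements (S - {b}))"
    using assms minus by (auto simp: derangements_def)
  finally show ?thesis .
qed

lemma evenperm_transpose_comp:
  assumes "p permutes S" "finite S" "a \<noteq> b"
  shows "evenperm (transpose a b \<circ> p) \<longleftrightarrow> \<not> evenperm p"
  using assms
  by (simp add: evenperm_comp evenperm_swap permutation_swap_id permutation_permutes[THEN iffD2] exI)

lemma parity_derangements_insert:
  assumes "finite S" "a \<notin> S"
  shows "parity_derangements c (insert a S) = (\<lambda>(b, p). transpose a b \<circ> p) `
    (SIGMA b:S. parity_derangements (\<not> c) S \<union> parity_derangements (\<not> c) (S - {b}))"
    (is "?L = ?f ` ?R")
proof (intro equalityI subsetI)
  fix q assume q: "q \<in> ?L"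
  then have "q permutes insert a S" by (simp add: parity_derangements_def derangements_def)
  \<comment> \<open>This decomposition still admits \<open>b = a\<close>, where the transposition is
    the identity and \<open>q\<close> fixes \<open>a\<close>; being a derangement rules that
    out.\<close>
  then have "q \<in> (\<lambda>(b, p). transpose a b \<circ> p) ` {(b, p). b \<in> insert a S \<and> p \<in> {p. p permutes S}}"
    by (subst permutes_insert[of a S, symmetric]) simp
  then obtain b p where bp: "b \<in> insert a S" "p permutes S" "q = transpose a b \<circ> p" by auto
  have "b \<in> S \<and> (p \<in> derangements S \<or> p \<in> derangements (S - {b}))"
    using q transpose_comp_in_derangements_iff[OF bp(2) assms(2) bp(1)] bp(3)
    by (simp add: parity_derangements_def)
  moreover from this have "a \<noteq> b" using assms by auto
  then have "evenperm q \<longleftrightarrow> \<not> evenperm p"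
    using evenperm_transpose_comp[OF bp(2) assms(1)] bp(3) by simp
  ultimately have "(b, p) \<in> ?R" using q by (auto simp: parity_derangements_def)
  then show "q \<in> ?f ` ?R" using bp(3) by force
next
  fix q assume "q \<in> ?f ` ?R"
  then obtain b p where bp: "b \<in> S" "q = transpose a b \<circ> p"
    "p \<in> parity_derangements (\<not> c) S \<union> parity_derangements (\<not> c) (S - {b})" by auto
  then have p: "p permutes S"
    by (auto simp: parity_derangements_def derangements_def intro: permutes_subset)
  have "a \<noteq> b" using bp(1) assms(2) by auto
  then have "evenperm q \<longleftrightarrow> \<not> evenperm p"
    using evenperm_transpose_comp[OF p assms(1)] bp(2) by simp
  then show "q \<in> ?L"
    using transpose_comp_in_derangements_iff[OF p assms(2), of b] bp
    by (auto simp: parity_derangements_def)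
qed

text \<open>Evaluating the composite at \<open>a\<close> recovers \<open>b\<close>, since
  \<open>p\<close> fixes \<open>a\<close>; composing with the same transposition again recovers
  \<open>p\<close>.\<close>

lemma inj_on_transpose_comp:
  assumes "a \<notin> S"
  shows "inj_on (\<lambda>(b, p). transpose a b \<circ> p) (UNIV \<times> {p. p permutes S})"
proof (rule inj_onI, clarify)
  fix b p b' p'
  assume p: "p permutes S" "p' permutes S" and eq: "transpose a b \<circ> p = transpose a b' \<circ> p'"
  have "p a = a" "p' a = a" using p assms by (simp_all add: permutes_not_in)
  then have "b = b'" using fun_cong[OF eq, of a] by simp
  moreover have "p = transpose a b \<circ> (transpose a b \<circ> p)" for b p by (simp add: fun_eq_iff)
  ultimately show "b = b' \<and> p = p'" using eq by metis
qed

lemma card_parity_derangements_insert: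
  assumes "finite S" "a \<notin> S"
  shows "card (parity_derangements c (insert a S)) =
    (\<Sum>b\<in>S. card (parity_derangements (\<not> c) S) + card (parity_derangements (\<not> c) (S - {b})))"
proof -
  let ?R = "SIGMA b:S. parity_derangements (\<not> c) S \<union> parity_derangements (\<not> c) (S - {b})"
  have "?R \<subseteq> UNIV \<times> {p. p permutes S}"
    by (auto simp: parity_derangements_def derangements_def intro: permutes_subset)
  then have "card (parity_derangements c (insert a S)) = card ?R"
    unfolding parity_derangements_insert[OF assms]
    by (intro card_image inj_on_subset[OF inj_on_transpose_comp[OF assms(2)]])
  also have "\<dots> = (\<Sum>b\<in>S. card (parity_derangements (\<not> c) S \<union> parity_derangements (\<not> c) (S - {b})))"
    using assms by (intro card_SigmaI) (auto simp: finite_parity_derangements)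
  also have "\<dots> = (\<Sum>b\<in>S. card (parity_derangements (\<not> c) S) + card (parity_derangements (\<not> c) (S - {b})))"
  proof (intro sum.cong refl card_Un_disjoint)
    fix b assume "b \<in> S"
    \<comment> \<open>Members of the first set move \<open>b\<close>, members of the second fix
      it.\<close>
    then show "parity_derangements (\<not> c) S \<inter> parity_derangements (\<not> c) (S - {b}) = {}"
      by (auto simp: parity_derangements_def derangements_def dest: permutes_not_in[where x = b])
  qed (use assms in \<open>auto simp: finite_parity_derangements\<close>)
  finally show ?thesis .
qed

lemma card_parity_derangements:
  "finite A \<Longrightarrow> card A = n \<Longrightarrow> card (parity_derangements c A) = parity_derangement_number c n"
proof (induction c n arbitrary: A rule: parity_derangement_number.induct)
  case (1 c)
  then have "parity_derangements c A = (if c then {id} else {})"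
    by (auto simp: parity_derangements_def derangements_def)
  then show ?case by simp
next
  case (2 c)
  then obtain a where "A = {a}" by (auto simp: card_1_singleton_iff)
  then have "parity_derangements c A = {}"
    by (auto simp: parity_derangements_def derangements_def)
  then show ?case by simp
next
  case (3 c n)
  from 3(4) obtain a S where A: "A = insert a S" "a \<notin> S" "card S = Suc n"
    unfolding card_Suc_eq[of A] by blast
  then have fin: "finite S" using 3(3) by simp
  \<comment> \<open>The summand is the same for all \<open>b\<close>, so the sum over
    \<open>S\<close> becomes the factor \<open>Suc n\<close>.\<close>
  then have "card (parity_derangements (\<not> c) (S - {b})) = parity_derangement_number (\<not> c) n"
    if "b \<in> S" for b
    using that A by (intro 3(1)) simp_all
  moreover have "card (parity_derangements (\<not> c) S) = parity_derangement_number (\<not> c) (Suc n)"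
    using A fin by (intro 3(2))
  ultimately show ?case
    using A fin by (simp add: card_parity_derangements_insert)
qed

lemma odd_derangement_number_eq: "odd_derangement_number n = parity_derangement_number False n"
  using card_parity_derangements[of "{1..n}" n False]
  by (simp add: odd_derangement_number_def parity_derangements_def)

text \<open>The base values are 130 (even) and 135 (odd) against 5! = 120; one index lower the bound
  fails, with 24 and 20 against 4! = 24. In the step, one term of the recurrence already grows by
  the same factor \<open>n + 6\<close> as the factorial. The flag stays arbitrary because the
  recurrence negates it.\<close>

lemma fact_less_parity_derangement_number:
  "fact (n + 5) < parity_derangement_number c (n + 6)"
proof (induction n arbitrary: c)
  case 0
  show ?case by (cases c) (simp_all add: eval_nat_numeral)
next
  case (Suc n)
  have "fact (Suc n + 5) = Suc (n + 5) * fact (n + 5)"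
    by (metis add_Suc fact_Suc of_nat_id)
  also have "\<dots> < Suc (n + 5) * parity_derangement_number (\<not> c) (n + 6)"
    using Suc by (intro mult_strict_left_mono) simp_all
  also have "\<dots> \<le> parity_derangement_number c (Suc (Suc (n + 5)))"
    unfolding parity_derangement_number.simps(3) by (intro mult_le_mono2) (simp add: add.commute)
  also have "Suc (Suc (n + 5)) = Suc n + 6" by simp
  finally show ?case .
qed

text \<open>The inequality is strict because the identity is an even permutation.\<close>

lemma odd_derangement_number_less_fact: "odd_derangement_number n < fact n"
proof -
  have "{p \<in> derangements {1..n}. \<not> evenperm p} \<subset> {p. p permutes {1..n}}"
  proof
    have "id \<in> {p. p permutes {1..n}}" by (simp add: permutes_id)
    moreover have "id \<notin> {p \<in> derangements {1..n}. \<not> evenperm p}" by simp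
    ultimately show "{p \<in> derangements {1..n}. \<not> evenperm p} \<noteq> {p. p permutes {1..n}}" by metis
  qed (auto simp: derangements_def)
  then have "odd_derangement_number n < card {p. p permutes {1..n}}"
    unfolding odd_derangement_number_def by (intro psubset_card_mono finite_permutations) auto
  also have "\<dots> = fact n" by (intro card_permutations) simp_all
  finally show ?thesis .
qed

lemma odd_derangement_number_eq_factD:
  assumes "odd_derangement_number n = fact m"
  shows "n \<le> 5"
proof (rule ccontr)
  assume "\<not> n \<le> 5"
  then have "n = (n - 6) + 6" by simp
  then obtain k where n: "n = k + 6" by metis
  have "fact (k + 5) < (fact m :: nat)"
    using fact_less_parity_derangement_number[of k False] assms
    by (simp add: n odd_derangement_number_eq)
  \<comment> \<open>Hence \<open>m\<close> is at least \<open>n\<close>, and \<open>fact m\<close>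
    is too large for the upper bound.\<close>
  then have "k + 5 < m" by (metis fact_mono_nat not_less)
  then have "fact n \<le> (fact m :: nat)" unfolding n by (intro fact_mono_nat) simp
  then show False using odd_derangement_number_less_fact[of n] assms by simp
qed

theorem proposition27:
  shows "{(n :: nat, m :: nat). n > 0 \<and> m > 0 \<and> odd_derangement_number n = fact m} = {(2, 1), (4, 3)}"
proof -
  have fact_less4: "m < 4" if "fact m < (fact 4 :: nat)" for m :: nat
    using that by (metis fact_mono_nat not_less)
  have small: "odd_derangement_number 1 = 0" "odd_derangement_number 2 = 1"
    "odd_derangement_number 3 = 0" "odd_derangement_number 4 = 6" "odd_derangement_number 5 = 20"
    by (simp_all add: odd_derangement_number_eq eval_nat_numeral)
  have "(n = 2 \<and> m = 1) \<or> (n = 4 \<and> m = 3)"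
    if nm: "n > 0" "m > 0" "odd_derangement_number n = fact m" for n m :: nat
  proof -
    have "n \<le> 5" using nm(3) by (rule odd_derangement_number_eq_factD)
    then have n: "n = 1 \<or> n = 2 \<or> n = 3 \<or> n = 4 \<or> n = 5" using nm(1) by arith
    \<comment> \<open>The values for \<open>n\<close> from 1 to 5 are 0, 1, 0, 6, 20, all below 4! =
      24. Among 1!, 2!, 3! only 1 and 6 then occur.\<close>
    have "fact m < (fact 4 :: nat)"
      using n nm(3) small by (auto simp: fact_numeral)
    then have "m = 1 \<or> m = 2 \<or> m = 3" using fact_less4[of m] nm(2) by arith
    then show ?thesis using n nm(3) small by (auto simp: fact_numeral)
  qed
  moreover have "odd_derangement_number 4 = fact 3" by (simp add: small fact_numeral)
  ultimately show ?thesis using small by auto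
qed

end
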